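(* Let $t$ be a transcendental number and $r$ a non-zero rational number. Then the numbers $1$, $\cosh(r\ln t)$ and $\sinh(r \ln t)$ are linearly independent over the field of algebraic numbers. In particular, $\cosh(r \ln t)$ and $\sinh(r\ln t)$ are transcendental.
   Context: $\ln$ denotes the principal value of the complex logarithm (argument in $(-\pi,\pi]$); $\cosh\theta = (e^{\theta}+e^{-\theta})/2$, $\sinh\theta = (e^{\theta}-e^{-\theta})/2$. A complex number is algebraic if it is a root of a non-trivial polynomial with rational coefficients; otherwise it is transcendental. *)

theory Defs
  imports "HOL-Analysis.Analysis" "HOL-Computational_Algebra.Polynomial"
begin

text \<open>
  Linear independence of a finite family (with repetitions counted) of elements of a field
  over a subfield \<open>K\<close>. The library predicates \<open>independent\<close> of the module and vector space
  locales need the scalars to be a whole type, and they speak about sets.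
\<close>

definition lin_independent_over :: "'a::field set \<Rightarrow> 'a list \<Rightarrow> bool" where
  "lin_independent_over K xs \<longleftrightarrow>
     (\<forall>c. (\<forall>i<length xs. c i \<in> K) \<and> (\<Sum>i<length xs. c i * xs ! i) = 0
        \<longrightarrow> (\<forall>i<length xs. c i = 0))"

end

theory Submission imports Defs begin

text \<open>
  With \<open>w = exp (r ln t)\<close> one has \<open>cosh (r ln t) = (w + 1/w) / 2\<close> and
  \<open>sinh (r ln t) = (w - 1/w) / 2\<close>, so a linear relation \<open>a + b cosh (r ln t) + c sinh (r ln t) = 0\<close>
  amounts to the quadratic equation \<open>(b + c) w\<^sup>2 + 2 a w + (b - c) = 0\<close>. If \<open>a\<close>, \<open>b\<close>, \<open>c\<close> are
  algebraic and not all zero, then completing the square shows that \<open>w\<close> is algebraic. But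
  writing \<open>r = p / q\<close> gives \<open>w ^ q = t powi p\<close>, and \<open>t\<close> would be algebraic as well.

  That the algebraic numbers form a field follows from the characterisation of an algebraic
  number as one whose powers lie in a finitely generated rational vector space.
\<close>

section \<open>The field of algebraic numbers, through finitely generated rational vector
  spaces\<close>

interpretation rat_vs: vector_space "\<lambda>(q::rat) (x::'a::field_char_0). of_rat q * x"
  by unfold_locales (simp_all add: algebra_simps of_rat_add of_rat_mult)

text \<open>The first \<open>card T + 1\<close> powers, if distinct, outnumber the generators, so
  they are linearly dependent over the rationals; the coefficients of the dependence form a
  polynomial with root \<open>x\<close>.\<close>

lemma algebraic_if_powers_in_span:
  fixes x :: "'a::field_char_0"
  assumes "finite T" and powers: "\<And>k. x ^ k \<in> rat_vs.span T"
  shows "algebraic x"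
proof (cases "inj_on (\<lambda>i. x ^ i) {..card T}")
  case True
  let ?S = "(\<lambda>i. x ^ i) ` {..card T}"
  have "card ?S = Suc (card T)"
    using card_image[OF True] by simp
  moreover have "?S \<subseteq> rat_vs.span T"
    using powers by auto
  ultimately have "rat_vs.dependent ?S"
    using rat_vs.independent_span_bound[OF \<open>finite T\<close>, of ?S] by auto
  then obtain u where u: "\<exists>v\<in>?S. u v \<noteq> 0" "(\<Sum>v\<in>?S. of_rat (u v) * v) = 0"
    by (subst (asm) rat_vs.dependent_finite) auto
  define p where "p = (\<Sum>i\<le>card T. monom (of_rat (u (x ^ i)) :: 'a) i)"
  have coeff_p: "coeff p i = (if i \<le> card T then of_rat (u (x ^ i)) else 0)" for i
    by (simp add: p_def coeff_sum)
  show ?thesis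
  proof (rule algebraicI')
    show "coeff p i \<in> \<rat>" for i
      by (simp add: coeff_p)
    obtain i where "i \<le> card T" "u (x ^ i) \<noteq> 0"
      using u(1) by auto
    then have "coeff p i \<noteq> 0"
      by (simp add: coeff_p)
    then show "p \<noteq> 0"
      by auto
    show "poly p x = 0"
      using u(2) by (simp add: p_def poly_sum poly_monom sum.reindex[OF True])
  qed
next
  \<comment> \<open>Coinciding powers collapse in a set, so no dependence arises from counting; here
    \<open>x\<close> is a root of X^j - X^i.\<close>
  case False
  then obtain i j where "i < j" "x ^ i = x ^ j"
    by (metis (no_types, lifting) inj_onI linorder_neqE_nat)
  show ?thesis
  proof (rule algebraicI')
    show "coeff (monom 1 j - monom 1 i :: 'a poly) k \<in> \<rat>" for k
      by simp
    have "coeff (monom 1 j - monom 1 i :: 'a poly) j \<noteq> 0"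
      using \<open>i < j\<close> by simp
    then show "monom 1 j - monom 1 i \<noteq> (0 :: 'a poly)"
      by (metis coeff_0)
    show "poly (monom 1 j - monom 1 i) x = 0"
      using \<open>x ^ i = x ^ j\<close> by (simp add: poly_monom)
  qed
qed

text \<open>Dividing by the leading coefficient expresses \<open>x ^ n\<close> through lower powers,
  so the span of the powers below \<open>n\<close> is closed under multiplication by
  \<open>x\<close>.\<close>

lemma algebraic_powers_in_span:
  fixes x :: "'a::field_char_0"
  assumes "algebraic x"
  obtains T where "finite T" "\<And>k. x ^ k \<in> rat_vs.span T"
proof -
  obtain p where p: "\<And>i. coeff p i \<in> \<rat>" "p \<noteq> 0" "poly p x = 0"
    using assms unfolding algebraic_altdef by blast
  define n where "n = degree p"
  define T where "T = (\<lambda>i. x ^ i) ` {..<n}"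
  have "(\<Sum>i<n. coeff p i * x ^ i) + coeff p n * x ^ n = 0"
    using p(3) by (simp add: poly_altdef n_def flip: lessThan_Suc_atMost)
  moreover have "coeff p n \<noteq> 0"
    using p(2) by (simp add: n_def)
  ultimately have xn_eq: "x ^ n = (\<Sum>i<n. (- coeff p i / coeff p n) * x ^ i)"
    by (simp add: sum_negf sum_divide_distrib[symmetric] field_simps eq_neg_iff_add_eq_0)
  have "c * x ^ i \<in> rat_vs.span T" if "c \<in> \<rat>" "i < n" for c i
  proof -
    obtain d where "c = of_rat d"
      using \<open>c \<in> \<rat>\<close> by (auto simp: Rats_def)
    moreover have "x ^ i \<in> T"
      using \<open>i < n\<close> by (auto simp: T_def)
    ultimately show ?thesis
      by (simp add: rat_vs.span_scale rat_vs.span_base)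
  qed
  then have "(\<Sum>i<n. (- coeff p i / coeff p n) * x ^ i) \<in> rat_vs.span T"
    by (intro rat_vs.span_sum) (simp_all only: lessThan_iff Rats_divide Rats_minus_iff p(1))
  then have xn: "x ^ n \<in> rat_vs.span T"
    by (simp only: xn_eq)
  have step: "x * y \<in> rat_vs.span T" if "y \<in> rat_vs.span T" for y
    using that
  proof (induction rule: rat_vs.span_induct_alt)
    case base
    show ?case by (simp add: rat_vs.span_zero)
  next
    case (step c v y)
    then obtain i where i: "i < n" "v = x ^ i"
      by (auto simp: T_def)
    have "x * v \<in> rat_vs.span T"
    proof (cases "Suc i = n")
      case True
      then show ?thesis using xn i by (metis power_Suc)
    next
      case False
      then have "x ^ Suc i \<in> T"
        using i unfolding T_def by (intro imageI) simp
      then show ?thesis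
        using i by (simp add: rat_vs.span_base)
    qed
    then have "of_rat c * (x * v) + x * y \<in> rat_vs.span T"
      using step by (intro rat_vs.span_add rat_vs.span_scale)
    then show ?case
      by (simp add: algebra_simps)
  qed
  have "x ^ k \<in> rat_vs.span T" for k
  proof (induction k)
    case 0
    show ?case
    \<comment> \<open>If \<open>n = 0\<close>, then \<open>T\<close> is empty and 1 is not a
      generator, but \<open>xn\<close> is then the claim itself.\<close>
    proof (cases "n = 0")
      case True
      then show ?thesis using xn by simp
    next
      case False
      then have "x ^ 0 \<in> T"
        unfolding T_def by (intro imageI) simp
      then show ?thesis by (rule rat_vs.span_base)
    qed
  next
    case (Suc k)
    then show ?case using step by simp
  qed
  moreover have "finite T"
    by (simp add: T_def)
  ultimately show ?thesis using that by blast
qed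

text \<open>Multiplication is bilinear: the outer induction decomposes \<open>x\<close>, the inner
  one decomposes \<open>y\<close> for a fixed generator \<open>a\<close>.\<close>

lemma span_mult:
  fixes x y :: "'a::field_char_0"
  assumes "x \<in> rat_vs.span A" "y \<in> rat_vs.span B"
  shows "x * y \<in> rat_vs.span ((\<lambda>(a, b). a * b) ` (A \<times> B))" (is "_ \<in> ?V")
  using assms(1)
proof (induction rule: rat_vs.span_induct_alt)
  case base
  show ?case by (simp add: rat_vs.span_zero)
next
  case (step c a x)
  have "a * y \<in> ?V"
    using assms(2)
  proof (induction rule: rat_vs.span_induct_alt)
    case base
    show ?case by (simp add: rat_vs.span_zero)
  next
    case (step d b y)
    have "a * b \<in> ?V"
      using \<open>a \<in> A\<close> \<open>b \<in> B\<close> by (intro rat_vs.span_base) auto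
    then have "of_rat d * (a * b) + a * y \<in> ?V"
      using step by (intro rat_vs.span_add rat_vs.span_scale)
    then show ?case
      by (simp add: algebra_simps)
  qed
  then have "of_rat c * (a * y) + x * y \<in> ?V"
    using step by (intro rat_vs.span_add rat_vs.span_scale)
  then show ?case
    by (simp add: algebra_simps)
qed

text \<open>One finite set \<open>?T\<close> spans all products \<open>x ^ i * y ^ j\<close>, and
  the powers of both \<open>x * y\<close> and \<open>x + y\<close> are rational combinations of
  these.\<close>

lemma
  fixes x y :: "'a::field_char_0"
  assumes "algebraic x" "algebraic y"
  shows algebraic_add: "algebraic (x + y)"
    and algebraic_mult: "algebraic (x * y)"
proof -
  obtain A where A: "finite A" "\<And>k. x ^ k \<in> rat_vs.span A"
    using algebraic_powers_in_span[OF assms(1)] by blast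
  obtain B where B: "finite B" "\<And>k. y ^ k \<in> rat_vs.span B"
    using algebraic_powers_in_span[OF assms(2)] by blast
  let ?T = "(\<lambda>(a, b). a * b) ` (A \<times> B)"
  have fin: "finite ?T"
    using A B by simp
  have mono: "x ^ i * y ^ j \<in> rat_vs.span ?T" for i j
    using A B by (intro span_mult)
  show "algebraic (x * y)"
    using mono by (intro algebraic_if_powers_in_span[OF fin]) (simp add: power_mult_distrib)
  show "algebraic (x + y)"
  proof (rule algebraic_if_powers_in_span[OF fin])
    fix k
    \<comment> \<open>The binomial coefficient is routed through the rationals to act as a scalar of
      \<open>rat_vs\<close>.\<close>
    have "of_rat (of_nat (k choose i)) * (x ^ i * y ^ (k - i)) \<in> rat_vs.span ?T" for i
      using mono by (intro rat_vs.span_scale)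
    then show "(x + y) ^ k \<in> rat_vs.span ?T"
      unfolding binomial_ring by (intro rat_vs.span_sum) (simp add: mult.assoc)
  qed
qed

lemma algebraic_diff:
  fixes x y :: "'a::field_char_0"
  assumes "algebraic x" "algebraic y"
  shows "algebraic (x - y)"
  using algebraic_add[OF assms(1) algebraic_minus[OF assms(2)]] by simp

lemma algebraic_divide:
  fixes x y :: "'a::field_char_0"
  assumes "algebraic x" "algebraic y"
  shows "algebraic (x / y)"
  using algebraic_mult[OF assms(1) algebraic_inverse[OF assms(2)]] by (simp add: field_simps)

lemma algebraic_power:
  fixes x :: "'a::field_char_0"
  assumes "algebraic x"
  shows "algebraic (x ^ n)"
  by (induction n) (simp_all add: algebraic_mult assms)

section \<open>Algebraic roots of powers and of quadratic equations\<close>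

lemma algebraic_power_imp_algebraic:
  fixes x :: "'a::field_char_0"
  assumes "algebraic (x ^ n)" "n > 0"
  shows "algebraic x"
  using assms(1)
  by (rule algebraic_root[where p = "monom 1 n"])
    (use assms(2) in \<open>auto simp: poly_monom degree_monom_eq\<close>)

lemma algebraic_quadratic_root:
  fixes a b c x :: "'a::field_char_0"
  assumes alg: "algebraic a" "algebraic b" "algebraic c"
    and nontrivial: "a \<noteq> 0 \<or> b \<noteq> 0 \<or> c \<noteq> 0"
    and root: "a * x\<^sup>2 + b * x + c = 0"
  shows "algebraic x"
proof (cases "a = 0")
  case True
  with root nontrivial have "b \<noteq> 0" by auto
  with True root have "x = - c / b"
    by (simp add: field_simps eq_neg_iff_add_eq_0)
  then show ?thesis
    by (simp add: algebraic_divide alg)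
next
  case False
  \<comment> \<open>Multiplying the equation by \<open>4 * a\<close> completes the square without
    division.\<close>
  have "(2 * a * x + b)\<^sup>2 = b\<^sup>2 - 4 * a * c"
    using root by algebra
  also have "algebraic \<dots>"
    by (intro algebraic_diff algebraic_mult algebraic_power alg algebraic_numeral)
  finally have "algebraic (2 * a * x + b)"
    by (rule algebraic_power_imp_algebraic) simp
  then have "algebraic ((2 * a * x + b - b) / (2 * a))"
    by (intro algebraic_diff algebraic_divide algebraic_mult alg algebraic_numeral)
  then show ?thesis
    using False by simp
qed

section \<open>Exponentials of rational multiples of the logarithm, and the linear relation\<close>

lemma algebraic_exp_rat_ln_imp_algebraic:
  fixes t :: complex and r :: rat
  assumes "r \<noteq> 0" "t \<noteq> 0" and alg: "algebraic (exp (of_rat r * ln t))"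
  shows "algebraic t"
proof -
  obtain p q :: int where r: "r = Fract p q" "q > 0"
    by (cases r) auto
  with \<open>r \<noteq> 0\<close> have "p \<noteq> 0"
    by (auto simp: rat_number_collapse)
  have "of_nat (nat q) * of_rat r = (of_int p :: complex)"
    using r by (simp add: of_rat_rat)
  then have "exp (of_rat r * ln t) ^ nat q = exp (of_int p * ln t)"
    by (metis exp_of_nat_mult mult.assoc)
  then have *: "algebraic (exp (of_int p * ln t))"
    using algebraic_power[OF alg] by metis
  \<comment> \<open>Root extraction needs a natural exponent, so for \<open>p\<close> not positive
    the inverse is taken.\<close>
  have "algebraic (t ^ nat \<bar>p\<bar>)"
  proof (cases "p > 0")
    case True
    then have "exp (of_int p * ln t) = t ^ nat \<bar>p\<bar>"
      using \<open>t \<noteq> 0\<close> exp_of_nat_mult[of "nat p" "ln t"] by simp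
    with * show ?thesis by simp
  next
    case False
    then have "inverse (exp (of_int p * ln t)) = t ^ nat \<bar>p\<bar>"
      using \<open>t \<noteq> 0\<close> exp_of_nat_mult[of "nat (- p)" "ln t"] by (simp flip: exp_minus)
    with algebraic_inverse[OF *] show ?thesis by simp
  qed
  then show ?thesis
    by (rule algebraic_power_imp_algebraic) (use \<open>p \<noteq> 0\<close> in simp)
qed

lemma cosh_sinh_relation_trivial:
  fixes a b c z :: complex
  assumes trans: "\<not> algebraic (exp z)"
    and alg: "algebraic a" "algebraic b" "algebraic c"
    and rel: "a + b * cosh z + c * sinh z = 0"
  shows "a = 0 \<and> b = 0 \<and> c = 0"
proof (rule ccontr)
  assume nontrivial: "\<not> ?thesis"
  have "2 * exp z * (a + b * cosh z + c * sinh z)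
      = (b + c) * (exp z)\<^sup>2 + 2 * a * exp z + (b - c)"
    by (simp add: cosh_field_def sinh_field_def exp_minus field_simps power2_eq_square)
  then have root: "(b + c) * (exp z)\<^sup>2 + 2 * a * exp z + (b - c) = 0"
    by (simp add: rel)
  \<comment> \<open>In characteristic 0, \<open>b + c\<close> and \<open>b - c\<close> vanish
    together only if \<open>b\<close> and \<open>c\<close> do.\<close>
  have "b + c \<noteq> 0 \<or> 2 * a \<noteq> 0 \<or> b - c \<noteq> 0"
    using nontrivial by auto
  then have "algebraic (exp z)"
    by (intro algebraic_quadratic_root[OF _ _ _ _ root] algebraic_add algebraic_diff
        algebraic_mult algebraic_numeral alg)
  with trans show False by contradiction
qed

theorem theorem5:
  fixes t :: complex and r :: rat
  assumes "\<not> algebraic t" and "r \<noteq> 0"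
  shows "lin_independent_over {z. algebraic z} [1, cosh (of_rat r * ln t), sinh (of_rat r * ln t)]
    \<and> \<not> algebraic (cosh (of_rat r * ln t))
    \<and> \<not> algebraic (sinh (of_rat r * ln t))"
proof -
  define z :: complex where "z = of_rat r * ln t"
  \<comment> \<open>Since 0 is algebraic; this secures \<open>exp (ln t) = t\<close>.\<close>
  have "t \<noteq> 0"
    using assms(1) by auto
  then have trans: "\<not> algebraic (exp z)"
    using algebraic_exp_rat_ln_imp_algebraic assms unfolding z_def by blast
  note trivial = cosh_sinh_relation_trivial[OF trans]
  have "lin_independent_over {z. algebraic z} [1, cosh z, sinh z]"
    unfolding lin_independent_over_def
  proof (intro allI impI, elim conjE)
    fix c :: "nat \<Rightarrow> complex" and i
    assume "\<forall>i<length [1, cosh z, sinh z]. c i \<in> {z. algebraic z}"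
      and "(\<Sum>i<length [1, cosh z, sinh z]. c i * [1, cosh z, sinh z] ! i) = 0"
      and "i < length [1, cosh z, sinh z]"
    then show "c i = 0"
      using trivial[of "c 0" "c 1" "c 2"]
      by (auto simp: numeral_3_eq_3 numeral_2_eq_2 less_Suc_eq)
  qed
  \<comment> \<open>If \<open>cosh z\<close> were algebraic, it could serve as a coefficient, and
    \<open>- cosh z + 1 * cosh z + 0 * sinh z = 0\<close> would be a nontrivial relation; likewise
    for \<open>sinh z\<close>.\<close>
  moreover have "\<not> algebraic (cosh z)"
    using trivial[of "- cosh z" 1 0] by auto
  moreover have "\<not> algebraic (sinh z)"
    using trivial[of "- sinh z" 0 1] by auto
  ultimately show ?thesis
    by (simp add: z_def)
qed

end
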